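(* Let $q$ be a prime power and let $v,d,k$ be integers with $2\le k\le v-2$, $d$ even and $4\le d\le 2\min\{k,v-k\}$. If $k\le v/2$, then $$\left\lfloor\frac{q^v-1}{q^k-1}\,A_q(v-1,d;k-1)\right\rfloor\ \le\ \left\lfloor\frac{q^v-1}{q^{v-k}-1}\,A_q(v-1,d;k)\right\rfloor,$$ where equality holds if and only if $v=2k$.
   Context: $A_q(v,d;k)$ denotes the maximum cardinality of a set of $k$-dimensional subspaces of $\mathbb{F}_q^v$ such that any two distinct members $U,W$ satisfy $\mathrm{d}_{\mathrm s}(U,W)\ge d$, where $\mathrm{d}_{\mathrm s}(U,W)=\dim(U)+\dim(W)-2\dim(U\cap W)$ (a set with a single element is always admissible). *)

theory Defs
  imports Complex_Main "HOL-Library.Function_Algebras" "HOL-Library.Cardinality"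
    "HOL-Number_Theory.Prime_Powers"
begin

text \<open>
  The space \<open>F\<^sub>q\<^sup>v\<close> is modelled inside the function space \<open>nat \<Rightarrow> 'a\<close>, where \<open>'a\<close> is a field
  with \<open>q\<close> elements: its vectors are the functions that vanish at all indices \<open>\<ge> v\<close>.
  Thus all \<open>F\<^sub>q\<^sup>v\<close> for varying \<open>v\<close> live in one type, and the library's notions of
  subspace and dimension apply.
\<close>

definition fun_scale :: "'a::field \<Rightarrow> (nat \<Rightarrow> 'a) \<Rightarrow> (nat \<Rightarrow> 'a)" where
  "fun_scale c x = (\<lambda>i. c * x i)"

interpretation fun_vs: vector_space fun_scale
  by unfold_locales (auto simp: fun_scale_def fun_eq_iff algebra_simps)

definition coord_space :: "nat \<Rightarrow> (nat \<Rightarrow> 'a::field) set" where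
  "coord_space v = {x. \<forall>i\<ge>v. x i = 0}"

definition grassmannian :: "nat \<Rightarrow> nat \<Rightarrow> (nat \<Rightarrow> 'a::field) set set" where
  "grassmannian v k = {U. U \<subseteq> coord_space v \<and> fun_vs.subspace U \<and> fun_vs.dim U = k}"

definition subspace_dist :: "(nat \<Rightarrow> 'a::field) set \<Rightarrow> (nat \<Rightarrow> 'a) set \<Rightarrow> int" where
  "subspace_dist U W =
     int (fun_vs.dim U) + int (fun_vs.dim W) - 2 * int (fun_vs.dim (U \<inter> W))"

definition cd_code :: "nat \<Rightarrow> nat \<Rightarrow> nat \<Rightarrow> (nat \<Rightarrow> 'a::field) set set \<Rightarrow> bool" where
  "cd_code v d k C \<longleftrightarrow>
     C \<subseteq> grassmannian v k \<and> (\<forall>U\<in>C. \<forall>W\<in>C. U \<noteq> W \<longrightarrow> int d \<le> subspace_dist U W)"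

text \<open>
  The number \<open>A\<^sub>q(v,d;k)\<close>; the field, and with it \<open>q\<close>, is passed as a type argument. As the
  field is finite, the maximum is over a finite set, which is nonempty because of the empty code.
\<close>

definition max_code_size :: "'a::{field,finite} itself \<Rightarrow> nat \<Rightarrow> nat \<Rightarrow> nat \<Rightarrow> nat" where
  "max_code_size _ v d k = Max (card ` {C :: (nat \<Rightarrow> 'a) set set. cd_code v d k C})"

end

theory Submission
  imports Defs "HOL-Library.Product_Plus" "HOL-Algebra.Algebraic_Closure_Type"
    "HOL-Number_Theory.Residues"
begin

text \<open>
  For \<open>v = 2k\<close> both sides agree, since taking orthogonal complements in \<open>F\<^sub>q\<^sup>v\<^sup>-\<^sup>1\<close> preserves the
  subspace distance. For \<open>v > 2k\<close> put \<open>t = k - d/2\<close>, \<open>n = v - 1 - k\<close>, and let \<open>a\<close> and \<open>b\<close> be the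
  left and right code sizes. Two codewords of dimension \<open>k - 1\<close> share no linearly independent
  \<open>t\<close>-tuple, which bounds \<open>a\<close> from above by
  \<open>\<Prod>i<t. (q\<^sup>v\<^sup>-\<^sup>1 - q\<^sup>i) / (q\<^sup>k\<^sup>-\<^sup>1 - q\<^sup>i)\<close>, while lifted Gabidulin codes give \<open>b \<ge> q^(n (t + 1))\<close>.
  As \<open>\<Prod>i\<le>t. (1 - q^(i - k)) > 1/2\<close>, this yields \<open>a (q^(v - k) - 1) < b (q^k - 1)\<close>. These are integers,
  so they differ by at least 1, and \<open>q^v - 1 \<ge> (q^k - 1) (q^(v - k) - 1)\<close> turns this into a
  difference of at least 1 between the two sides before rounding.
\<close>

section \<open>Subspaces over a finite field and the upper bound\<close>

text \<open>Every vector of the larger span is \<open>scale c b + x\<close> with unique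
  \<open>c\<close> and \<open>x\<close> in \<open>span B\<close>, so each basis vector multiplies
  the count by q. Kept generic because subspaces of both the function space and the algebraic
  closure are counted this way.\<close>

lemma (in vector_space) card_span_independent:
  assumes "finite (UNIV :: 'a set)" "finite B" "independent B"
  shows "finite (span B) \<and> card (span B) = CARD('a) ^ card B"
  using assms(2,3)
proof (induction B)
  case empty
  then show ?case by simp
next
  case (insert b B)
  have b: "b \<notin> span B" and IH: "finite (span B)" "card (span B) = CARD('a) ^ card B"
    using insert by (auto simp: independent_insert)
  let ?f = "\<lambda>(c, x). scale c b + x"
  have im: "span (insert b B) = ?f ` (UNIV \<times> span B)"
  proof (intro Set.set_eqI iffI)
    fix x assume "x \<in> span (insert b B)"
    then obtain c where c: "x - scale c b \<in> span B"
      by (auto simp: span_insert)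
    then show "x \<in> ?f ` (UNIV \<times> span B)"
      by (intro image_eqI[of _ _ "(c, x - scale c b)"]) auto
  next
    fix x assume "x \<in> ?f ` (UNIV \<times> span B)"
    then obtain c y where "x = scale c b + y" "y \<in> span B" by auto
    then show "x \<in> span (insert b B)"
      by (auto simp: span_insert intro!: exI[of _ c])
  qed
  have inj: "inj_on ?f (UNIV \<times> span B)"
  proof (rule inj_onI, clarify)
    fix c x c' x' assume x: "x \<in> span B" "x' \<in> span B" and eq: "scale c b + x = scale c' b + x'"
    have *: "scale (c - c') b = x' - x"
      using eq by (simp add: scale_left_diff_distrib algebra_simps)
    have "c = c'"
    proof (rule ccontr)
      assume "c \<noteq> c'"
      then have "b = scale (inverse (c - c')) (x' - x)"
        by (metis * eq_iff_diff_eq_0 left_inverse scale_one scale_scale)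
      then show False
        using b x by (metis span_diff span_scale)
    qed
    then show "c = c' \<and> x = x'" using eq by simp
  qed
  show ?case
    using IH insert.hyps assms(1) by (simp add: im card_image[OF inj] card_cartesian_product)
qed

lemma (in vector_space) card_subspace:
  assumes "finite (UNIV :: 'a set)" "subspace S" "finite S"
  shows "card S = CARD('a) ^ dim S"
proof -
  obtain B where B: "B \<subseteq> S" "independent B" "S \<subseteq> span B" "card B = dim S"
    by (rule basis_exists)
  then have "span B = S"
    using assms(2) by (simp add: span_minimal subset_antisym)
  then show ?thesis
    using card_span_independent[OF assms(1) _ B(2)] B assms(3) finite_subset by metis
qed

lemma one_less_CARD_field: "1 < CARD('a::{field,finite})"
proof -
  have "card {0, 1 :: 'a} \<le> CARD('a)" by (intro card_mono) auto
  then show ?thesis by simp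
qed

lemma coord_space_mono: "m \<le> n \<Longrightarrow> coord_space m \<subseteq> coord_space n"
  by (auto simp: coord_space_def)

lemma subspace_coord_space: "fun_vs.subspace (coord_space n)"
  by (auto simp: fun_vs.subspace_def coord_space_def fun_scale_def)

lemma finite_card_coord_space:
  "finite (coord_space n :: (nat \<Rightarrow> 'a::{field,finite}) set) \<and>
   card (coord_space n :: (nat \<Rightarrow> 'a) set) = CARD('a) ^ n"
proof (induction n)
  case 0
  have "coord_space 0 = {0 :: nat \<Rightarrow> 'a}" by (auto simp: coord_space_def)
  then show ?case by simp
next
  case (Suc n)
  let ?f = "\<lambda>(c :: 'a, x). x(n := c)"
  have im: "coord_space (Suc n) = ?f ` (UNIV \<times> coord_space n)"
  proof (intro Set.set_eqI iffI)
    fix x :: "nat \<Rightarrow> 'a" assume "x \<in> coord_space (Suc n)"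
    then show "x \<in> ?f ` (UNIV \<times> coord_space n)"
      by (intro image_eqI[of _ _ "(x n, x(n := 0))"]) (auto simp: coord_space_def)
  qed (auto simp: coord_space_def)
  have inj: "inj_on ?f (UNIV \<times> coord_space n)"
  proof (rule inj_onI, clarify)
    fix c c' :: 'a and x x' assume "x \<in> coord_space n" "x' \<in> coord_space n" "x(n := c) = x'(n := c')"
    then show "c = c' \<and> x = x'"
      by (simp add: fun_eq_iff coord_space_def) (metis le_refl)
  qed
  show ?case
    using Suc by (simp add: im card_image[OF inj] card_cartesian_product)
qed

lemmas finite_coord_space = finite_card_coord_space[THEN conjunct1]
  and card_coord_space = finite_card_coord_space[THEN conjunct2]

lemma card_subspace_coord_space:
  fixes U :: "(nat \<Rightarrow> 'a::{field,finite}) set"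
  assumes "fun_vs.subspace U" "U \<subseteq> coord_space n"
  shows "card U = CARD('a) ^ fun_vs.dim U"
  using assms finite_subset[OF _ finite_coord_space] by (intro fun_vs.card_subspace) auto

text \<open>As q > 1, the cardinality determines the dimension; dimensions of complements and
  codewords are found by counting.\<close>

lemma dim_eq_of_card:
  fixes U :: "(nat \<Rightarrow> 'a::{field,finite}) set"
  assumes "fun_vs.subspace U" "U \<subseteq> coord_space n" "card U = CARD('a) ^ m"
  shows "fun_vs.dim U = m"
  using card_subspace_coord_space[OF assms(1,2)] assms(3) one_less_CARD_field[where 'a = 'a]
  by simp

lemma dim_coord_space: "fun_vs.dim (coord_space n :: (nat \<Rightarrow> 'a::{field,finite}) set) = n"
  by (rule dim_eq_of_card[OF subspace_coord_space subset_refl card_coord_space])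

lemma dim_le_of_subspace:
  fixes U :: "(nat \<Rightarrow> 'a::{field,finite}) set"
  assumes "fun_vs.subspace U" "U \<subseteq> coord_space n"
  shows "fun_vs.dim U \<le> n"
proof -
  have "CARD('a) ^ fun_vs.dim U \<le> CARD('a) ^ n"
    using card_mono[OF finite_coord_space assms(2)]
    by (simp add: card_subspace_coord_space[OF assms] card_coord_space)
  then show ?thesis
    using one_less_CARD_field[where 'a = 'a] by simp
qed

section \<open>Finiteness of codes and attainment of the maximum\<close>

lemma finite_grassmannian: "finite (grassmannian n k :: (nat \<Rightarrow> 'a::{field,finite}) set set)"
  by (rule finite_subset[of _ "Pow (coord_space n)"])
     (auto simp: grassmannian_def finite_coord_space)

lemma finite_cd_codes: "finite {C :: (nat \<Rightarrow> 'a::{field,finite}) set set. cd_code n d k C}"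
  by (rule finite_subset[of _ "Pow (grassmannian n k)"])
     (auto simp: cd_code_def finite_grassmannian)

lemma card_le_max_code_size:
  fixes C :: "(nat \<Rightarrow> 'a::{field,finite}) set set"
  shows "cd_code n d k C \<Longrightarrow> card C \<le> max_code_size TYPE('a) n d k"
  unfolding max_code_size_def by (rule Max_ge) (auto simp: finite_cd_codes)

lemma max_code_size_attained:
  obtains C :: "(nat \<Rightarrow> 'a::{field,finite}) set set"
  where "cd_code n d k C" "card C = max_code_size TYPE('a) n d k"
proof -
  have "cd_code n d k ({} :: (nat \<Rightarrow> 'a) set set)" by (simp add: cd_code_def)
  then have "max_code_size TYPE('a) n d k \<in> card ` {C :: (nat \<Rightarrow> 'a) set set. cd_code n d k C}"
    unfolding max_code_size_def by (intro Max_in) (auto simp: finite_cd_codes)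
  then show thesis using that by auto
qed

section \<open>Independent tuples and the packing bound\<close>

text \<open>The recursion on ordered lists makes the number of one-step extensions directly
  computable: a new head only has to avoid the span of the tail.\<close>

primrec independent_list :: "(nat \<Rightarrow> 'a::field) list \<Rightarrow> bool" where
  "independent_list [] \<longleftrightarrow> True"
| "independent_list (x # xs) \<longleftrightarrow> x \<notin> fun_vs.span (set xs) \<and> independent_list xs"

lemma independent_list_imp:
  "independent_list xs \<Longrightarrow> fun_vs.independent (set xs) \<and> card (set xs) = length xs"
proof (induction xs)
  case (Cons x xs)
  then have "x \<notin> set xs" using fun_vs.span_base by auto
  with Cons show ?case by (simp add: fun_vs.independent_insert)
qed (simp add: fun_vs.independent_empty)

lemma card_span_independent_list:
  fixes xs :: "(nat \<Rightarrow> 'a::{field,finite}) list"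
  shows "independent_list xs \<Longrightarrow> finite (fun_vs.span (set xs)) \<and>
    card (fun_vs.span (set xs)) = CARD('a) ^ length xs"
  using fun_vs.card_span_independent[of "set xs"] independent_list_imp[of xs] by simp

definition independent_tuples :: "(nat \<Rightarrow> 'a::field) set \<Rightarrow> nat \<Rightarrow> (nat \<Rightarrow> 'a) list set" where
  "independent_tuples U t = {xs. independent_list xs \<and> set xs \<subseteq> U \<and> length xs = t}"

text \<open>A tuple of length \<open>t\<close> spans q^t vectors of \<open>U\<close>, and every
  other vector of \<open>U\<close> is a possible new head. If \<open>t\<close> exceeds the dimension
  m of \<open>U\<close>, the factor at i = m vanishes, in accordance with there being no such
  tuples.\<close>

lemma card_independent_tuples:
  fixes U :: "(nat \<Rightarrow> 'a::{field,finite}) set"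
  assumes "fun_vs.subspace U" "finite U"
  shows "finite (independent_tuples U t) \<and>
    card (independent_tuples U t) = (\<Prod>i<t. CARD('a) ^ fun_vs.dim U - CARD('a) ^ i)"
proof (induction t)
  case 0
  have "independent_tuples U 0 = {[]}" by (auto simp: independent_tuples_def)
  then show ?case by simp
next
  case (Suc t)
  let ?S = "SIGMA xs:independent_tuples U t. U - fun_vs.span (set xs)"
  have "independent_tuples U (Suc t) = (\<lambda>(xs, x). x # xs) ` ?S"
    by (force simp: independent_tuples_def image_iff length_Suc_conv)
  moreover have "inj_on (\<lambda>(xs, x). x # xs) ?S" by (auto simp: inj_on_def)
  moreover have "card (U - fun_vs.span (set xs)) = CARD('a) ^ fun_vs.dim U - CARD('a) ^ t"
    if "xs \<in> independent_tuples U t" for xs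
  proof -
    have xs: "independent_list xs" "set xs \<subseteq> U" "length xs = t"
      using that by (auto simp: independent_tuples_def)
    have "fun_vs.span (set xs) \<subseteq> U"
      using xs(2) assms(1) by (rule fun_vs.span_minimal)
    then show ?thesis
      using card_span_independent_list[OF xs(1)] xs(3) fun_vs.card_subspace[OF finite assms]
      by (simp add: card_Diff_subset)
  qed
  ultimately show ?case
    using Suc assms(2) by (simp add: card_image)
qed

text \<open>Distinct codewords share no independent \<open>t\<close>-tuple, since it would span a
  \<open>t\<close>-dimensional subspace of their intersection. So the tuple sets of the codewords
  are disjoint parts of the tuple set of the whole space.\<close>

lemma card_code_le:
  fixes C :: "(nat \<Rightarrow> 'a::{field,finite}) set set"
  assumes C: "C \<subseteq> grassmannian n m"
    and t: "\<And>U W. \<lbrakk>U \<in> C; W \<in> C; U \<noteq> W\<rbrakk> \<Longrightarrow> fun_vs.dim (U \<inter> W) < t"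
  shows "card C * (\<Prod>i<t. CARD('a) ^ m - CARD('a) ^ i) \<le> (\<Prod>i<t. CARD('a) ^ n - CARD('a) ^ i)"
proof -
  have sub: "fun_vs.subspace U" "U \<subseteq> coord_space n" "fun_vs.dim U = m" if "U \<in> C" for U
    using C that by (auto simp: grassmannian_def)
  then have finU: "finite U" if "U \<in> C" for U
    using that finite_subset[OF _ finite_coord_space] by blast
  have fin: "finite C" by (rule finite_subset[OF C finite_grassmannian])
  have disj: "independent_tuples U t \<inter> independent_tuples W t = {}"
    if UW: "U \<in> C" "W \<in> C" "U \<noteq> W" for U W
  proof (rule ccontr)
    assume "\<not> ?thesis"
    then obtain xs where xs: "independent_list xs" "set xs \<subseteq> U" "set xs \<subseteq> W" "length xs = t"
      by (auto simp: independent_tuples_def)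
    have s: "fun_vs.subspace (U \<inter> W)"
      using sub UW by (simp add: fun_vs.subspace_inter)
    have "fun_vs.span (set xs) \<subseteq> U \<inter> W"
      using xs s by (intro fun_vs.span_minimal) auto
    then have "card (fun_vs.span (set xs)) \<le> card (U \<inter> W)"
      using finU UW by (intro card_mono) auto
    then have "CARD('a) ^ t \<le> CARD('a) ^ fun_vs.dim (U \<inter> W)"
      using card_span_independent_list[OF xs(1)] xs(4)
        card_subspace_coord_space[OF s le_infI1[OF sub(2)[OF UW(1)]]] by simp
    then show False
      using t[OF UW] one_less_CARD_field[where 'a = 'a] by simp
  qed
  have "card (independent_tuples U t) = (\<Prod>i<t. CARD('a) ^ m - CARD('a) ^ i)" if "U \<in> C" for U
    using card_independent_tuples[of U t] sub[OF that] finU[OF that] by simp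
  then have "card C * (\<Prod>i<t. CARD('a) ^ m - CARD('a) ^ i) = (\<Sum>U\<in>C. card (independent_tuples U t))"
    by simp
  also have "\<dots> = card (\<Union>U\<in>C. independent_tuples U t)"
    using fin disj sub finU
    by (intro card_UN_disjoint[symmetric]) (auto simp: card_independent_tuples)
  also have "\<dots> \<le> card (independent_tuples (coord_space n :: (nat \<Rightarrow> 'a) set) t)"
  proof (rule card_mono)
    show "finite (independent_tuples (coord_space n :: (nat \<Rightarrow> 'a) set) t)"
      by (rule card_independent_tuples[OF subspace_coord_space finite_coord_space, THEN conjunct1])
    show "(\<Union>U\<in>C. independent_tuples U t) \<subseteq> independent_tuples (coord_space n) t"
      using sub(2) unfolding independent_tuples_def by blast
  qed
  also have "\<dots> = (\<Prod>i<t. CARD('a) ^ n - CARD('a) ^ i)"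
    using card_independent_tuples[OF subspace_coord_space finite_coord_space, where 'a = 'a]
    by (simp add: dim_coord_space)
  finally show ?thesis .
qed

section \<open>Orthogonal complements\<close>

text \<open>All fibres over the image are translates of the kernel. The hypothesis on differences
  combines closure of \<open>S\<close> and additivity of \<open>f\<close> on \<open>S\<close>; sums
  are recovered as x - (0 - y).\<close>

lemma card_eq_card_image_times_kernel:
  assumes "finite S"
    and diff: "\<And>x y. x \<in> S \<Longrightarrow> y \<in> S \<Longrightarrow> x - y \<in> S \<and> f (x - y) = f x - f y"
  shows "card S = card (f ` S) * card {x \<in> (S :: 'b::ab_group_add set). (f x :: 'c::ab_group_add) = 0}"
proof -
  have zero: "0 \<in> S" if "x \<in> S" for x using diff[OF that that] by simp
  have add: "x + y \<in> S \<and> f (x + y) = f x + f y" if "x \<in> S" "y \<in> S" for x y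
  proof -
    have "f 0 = 0" using diff[OF that(1) that(1)] by simp
    then have y: "0 - y \<in> S" "f (0 - y) = - f y" using diff[OF zero[OF that(1)] that(2)] by auto
    show ?thesis using diff[OF that(1) y(1)] y(2) by simp
  qed
  have fib: "card {x \<in> S. f x = c} = card {x \<in> S. f x = 0}" if c: "c \<in> f ` S" for c
  proof -
    obtain a where a: "a \<in> S" "f a = c" using c by auto
    show ?thesis
    proof (rule bij_betw_same_card)
      show "bij_betw (\<lambda>x. x - a) {x \<in> S. f x = c} {x \<in> S. f x = 0}"
        by (rule bij_betw_byWitness[of _ "\<lambda>x. x + a"]) (use a diff add in auto)
    qed
  qed
  have "card S = (\<Sum>c\<in>f ` S. card {x \<in> S. f x = c})"
    using sum.image_gen[OF assms(1), of "\<lambda>_. 1 :: nat" f] by simp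
  also have "\<dots> = card (f ` S) * card {x \<in> S. f x = 0}"
    using fib by simp
  finally show ?thesis .
qed

text \<open>Multiples of \<open>x\<close> already make \<open>g\<close> take every value, so the
  image has exactly q elements.\<close>

lemma card_kernel_functional:
  fixes S :: "(nat \<Rightarrow> 'a::{field,finite}) set"
  assumes S: "fun_vs.subspace S" "finite S"
    and lin: "\<And>x y. g (x - y) = g x - g y" "\<And>c x. g (fun_scale c x) = c * (g x :: 'a)"
    and nz: "x \<in> S" "g x \<noteq> 0"
  shows "card S = CARD('a) * card {x \<in> S. g x = 0}"
proof -
  have "c \<in> g ` S" for c
  proof (rule image_eqI)
    show "c = g (fun_scale (c / g x) x)" using nz(2) by (simp add: lin)
    show "fun_scale (c / g x) x \<in> S" using S(1) nz(1) by (rule fun_vs.subspace_scale)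
  qed
  then have "g ` S = UNIV" by auto
  then show ?thesis
    using card_eq_card_image_times_kernel[OF S(2), of g] lin(1) S(1) by (simp add: fun_vs.subspace_diff)
qed

definition orth :: "nat \<Rightarrow> (nat \<Rightarrow> 'a::field) set \<Rightarrow> (nat \<Rightarrow> 'a) set" where
  "orth n U = {x \<in> coord_space n. \<forall>u\<in>U. (\<Sum>i<n. x i * u i) = 0}"

lemma orth_subset: "orth n U \<subseteq> coord_space n"
  by (auto simp: orth_def)

lemma subspace_orth: "fun_vs.subspace (orth n U)"
  using subspace_coord_space[of n]
  by (auto simp: fun_vs.subspace_def orth_def fun_scale_def distrib_right sum.distrib mult.assoc
      simp flip: sum_distrib_left)

lemma subset_orth_orth: "U \<subseteq> coord_space n \<Longrightarrow> U \<subseteq> orth n (orth n U)"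
  by (auto simp: orth_def mult.commute)

text \<open>Over a finite field \<open>U\<close> may meet its complement nontrivially, so no direct
  sum argument applies. Instead the pairs (x, u) with zero dot product are counted twice. A vector x
  pairs to zero with all of \<open>U\<close> or with a q-th part of it; a vector u does so with the
  whole space if u = 0 and with a q-th part otherwise.\<close>

lemma card_orth:
  fixes U :: "(nat \<Rightarrow> 'a::{field,finite}) set"
  assumes U: "fun_vs.subspace U" "U \<subseteq> coord_space n"
  shows "card (orth n U) * card U = CARD('a) ^ n"
proof -
  define V :: "(nat \<Rightarrow> 'a) set" where "V = coord_space n"
  define ip where "ip x y = (\<Sum>i<n. x i * y i)" for x y :: "nat \<Rightarrow> 'a"
  let ?q = "CARD('a)" and ?O = "orth n U"
  have V: "fun_vs.subspace V" "finite V" "card V = ?q ^ n"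
    by (simp_all add: V_def subspace_coord_space finite_coord_space card_coord_space)
  have finU: "finite U" using U(2) V(2) unfolding V_def by (rule finite_subset)
  have lin: "ip (x - y) z = ip x z - ip y z" "ip (fun_scale c x) z = c * ip x z" for x y z c
    by (simp_all add: ip_def fun_scale_def left_diff_distrib sum_subtractf sum_distrib_left mult.assoc)
  have sym: "ip x y = ip y x" for x y by (simp add: ip_def mult.commute)
  have OV: "?O \<subseteq> V" by (simp add: V_def orth_subset)
  have O_iff: "x \<in> ?O \<longleftrightarrow> x \<in> V \<and> (\<forall>u\<in>U. ip x u = 0)" for x
    by (simp add: orth_def V_def ip_def)
  have left: "?q * card {u \<in> U. ip x u = 0} = (if x \<in> ?O then ?q * card U else card U)"
    if x: "x \<in> V" for x
  proof (cases "x \<in> ?O")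
    case True
    then have "{u \<in> U. ip x u = 0} = U" by (auto simp: O_iff)
    with True show ?thesis by simp
  next
    case False
    then obtain u where u: "u \<in> U" "ip u x \<noteq> 0" using x by (auto simp: O_iff sym[of x])
    show ?thesis
      using card_kernel_functional[of U "\<lambda>y. ip y x" u, OF U(1) finU lin u] False by (simp add: sym[of x])
  qed
  have right: "?q * card {x \<in> V. ip x u = 0} = (if u = 0 then ?q * ?q ^ n else ?q ^ n)"
    if u: "u \<in> U" for u
  proof (cases "u = 0")
    case True
    then have "{x \<in> V. ip x u = 0} = V" by (auto simp: ip_def)
    with True show ?thesis by (simp add: V)
  next
    case False
    then obtain j where j: "u j \<noteq> 0" by (auto simp: fun_eq_iff)
    then have "j < n"
      using u U(2) unfolding coord_space_def by (metis (mono_tags) mem_Collect_eq not_le subsetD)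
    \<comment> \<open>The unit vector at a nonzero coordinate of \<open>u\<close> shows that pairing
      with \<open>u\<close> is not the zero functional.\<close>
    define e where "e = (\<lambda>i. if i = j then 1 else 0 :: 'a)"
    have "ip e u = (\<Sum>i<n. if i = j then u i else 0)"
      unfolding ip_def e_def by (intro sum.cong) auto
    also have "\<dots> = u j" using \<open>j < n\<close> by simp
    finally have "ip e u \<noteq> 0" using j by simp
    moreover have "e \<in> V" using \<open>j < n\<close> by (auto simp: V_def e_def coord_space_def)
    ultimately show ?thesis
      using card_kernel_functional[of V "\<lambda>x. ip x u" e, OF V(1,2) lin] False V(3) by simp
  qed
  have "(\<Sum>x\<in>V. card {u \<in> U. ip x u = 0}) = (\<Sum>u\<in>U. card {x \<in> V. ip x u = 0})"
    using sum.swap_restrict[OF V(2) finU, of "\<lambda>_ _. 1 :: nat" "\<lambda>x u. ip x u = 0"] by simp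
  then have "(\<Sum>x\<in>V. ?q * card {u \<in> U. ip x u = 0}) = (\<Sum>u\<in>U. ?q * card {x \<in> V. ip x u = 0})"
    by (simp flip: sum_distrib_left)
  then have "(\<Sum>x\<in>V. if x \<in> ?O then ?q * card U else card U) =
      (\<Sum>u\<in>U. if u = 0 then ?q * ?q ^ n else ?q ^ n)"
    using left right by simp
  moreover have "(\<Sum>x\<in>V. if x \<in> ?O then ?q * card U else card U) =
      card ?O * (?q * card U) + (?q ^ n - card ?O) * card U"
  proof -
    have "V \<inter> {x. x \<in> ?O} = ?O" "V \<inter> - {x. x \<in> ?O} = V - ?O"
      using OV by auto
    then show ?thesis
      using V(2,3) OV finite_subset[OF OV V(2)] by (simp add: sum.If_cases card_Diff_subset)
  qed
  moreover have "(\<Sum>u\<in>U. if u = 0 then ?q * ?q ^ n else ?q ^ n) =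
      ?q * ?q ^ n + (card U - 1) * ?q ^ n"
    using finU fun_vs.subspace_0[OF U(1)] by (simp add: sum.remove[of U 0])
  ultimately have eq: "card ?O * (?q * card U) + (?q ^ n - card ?O) * card U =
      ?q * ?q ^ n + (card U - 1) * ?q ^ n" by simp
  have le: "card ?O \<le> ?q ^ n" using card_mono[OF V(2) OV] V(3) by simp
  have pos: "1 \<le> card U"
    using finU fun_vs.subspace_0[OF U(1)] by (metis One_nat_def Suc_leI card_gt_0_iff empty_iff)
  \<comment> \<open>Over the integers the truncated differences become genuine ones, and after
    rearranging, the factor q - 1 can be cancelled.\<close>
  have "int (card ?O) * (int ?q * int (card U)) + (int (?q ^ n) - int (card ?O)) * int (card U) =
      int ?q * int (?q ^ n) + (int (card U) - 1) * int (?q ^ n)"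
    using arg_cong[OF eq, of int] le pos
    by (simp only: of_nat_add of_nat_mult of_nat_diff of_nat_1)
  then have "(int ?q - 1) * int (card ?O * card U) = (int ?q - 1) * int (?q ^ n)"
    by (simp add: algebra_simps)
  then have "int (card ?O * card U) = int (?q ^ n)"
    using one_less_CARD_field[where 'a = 'a] by simp
  then show ?thesis by (simp only: of_nat_eq_iff)
qed

lemma dim_orth:
  fixes U :: "(nat \<Rightarrow> 'a::{field,finite}) set"
  assumes U: "fun_vs.subspace U" "U \<subseteq> coord_space n"
  shows "fun_vs.dim (orth n U) = n - fun_vs.dim U"
proof -
  have "CARD('a) ^ (n - fun_vs.dim U) * CARD('a) ^ fun_vs.dim U = CARD('a) ^ n"
    using dim_le_of_subspace[OF U] by (simp flip: power_add)
  then have "card (orth n U) = CARD('a) ^ (n - fun_vs.dim U)"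
    using card_orth[OF U] one_less_CARD_field[where 'a = 'a]
    unfolding card_subspace_coord_space[OF U]
    by (metis less_nat_zero_code mult_right_cancel power_eq_0_iff)
  then show ?thesis
    by (rule dim_eq_of_card[OF subspace_orth orth_subset])
qed

text \<open>One inclusion is immediate, and \<open>card_orth\<close> for \<open>U\<close> and for
  its complement gives equal cardinalities.\<close>

lemma orth_orth:
  fixes U :: "(nat \<Rightarrow> 'a::{field,finite}) set"
  assumes U: "fun_vs.subspace U" "U \<subseteq> coord_space n"
  shows "orth n (orth n U) = U"
proof (rule card_subset_eq[symmetric])
  show "finite (orth n (orth n U))"
    using orth_subset finite_coord_space by (rule finite_subset)
  show "U \<subseteq> orth n (orth n U)" using U(2) by (rule subset_orth_orth)
  have "CARD('a) ^ n \<noteq> 0" by simp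
  then have "card (orth n U) \<noteq> 0" using card_orth[OF U] by (metis mult_0)
  moreover have "card (orth n U) * card (orth n (orth n U)) = card (orth n U) * card U"
    using card_orth[OF U] card_orth[OF subspace_orth orth_subset, of n U] by (simp add: mult.commute)
  ultimately show "card U = card (orth n (orth n U))" by simp
qed

text \<open>The two complements intersect in the complement of the sum U + W. The dimension of the
  sum comes from counting: the addition map on \<open>U \<times> W\<close> has kernel {(x, -x)}, a
  copy of the intersection.\<close>

lemma dim_Int_orth:
  fixes U W :: "(nat \<Rightarrow> 'a::{field,finite}) set"
  assumes U: "fun_vs.subspace U" "U \<subseteq> coord_space n"
    and W: "fun_vs.subspace W" "W \<subseteq> coord_space n"
  shows "int (fun_vs.dim (orth n U \<inter> orth n W)) =
    int n - int (fun_vs.dim U) - int (fun_vs.dim W) + int (fun_vs.dim (U \<inter> W))"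
proof -
  let ?f = "\<lambda>(x, y). x + y :: nat \<Rightarrow> 'a"
  define S where "S = ?f ` (U \<times> W)"
  have S_eq: "S = {x + y |x y. x \<in> U \<and> y \<in> W}" by (auto simp: S_def)
  have S: "fun_vs.subspace S" "S \<subseteq> coord_space n"
    using fun_vs.subspace_sums[OF U(1) W(1)] U(2) W(2)
    by (auto simp: S_eq coord_space_def subset_iff)
  have fin: "finite U" "finite W"
    using U(2) W(2) finite_subset[OF _ finite_coord_space] by blast+
  have I: "fun_vs.subspace (U \<inter> W)" "U \<inter> W \<subseteq> coord_space n"
    using U W by (auto simp: fun_vs.subspace_inter)
  have "card (U \<times> W) = card S * card {p \<in> U \<times> W. ?f p = 0}"
    unfolding S_def
    by (rule card_eq_card_image_times_kernel) (use fin U(1) W(1) in \<open>auto simp: fun_vs.subspace_diff\<close>)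
  moreover have "bij_betw (\<lambda>x. (x, - x)) (U \<inter> W) {p \<in> U \<times> W. ?f p = 0}"
  proof (rule bij_betw_byWitness[of _ fst])
    show "fst ` {p \<in> U \<times> W. ?f p = 0} \<subseteq> U \<inter> W"
      using fun_vs.subspace_neg[OF W(1)] by (auto simp: eq_neg_iff_add_eq_0[symmetric])
  qed (use W(1) in \<open>auto simp: add_eq_0_iff fun_vs.subspace_neg\<close>)
  ultimately have "card U * card W = card S * card (U \<inter> W)"
    by (simp add: card_cartesian_product bij_betw_same_card)
  then have "CARD('a) ^ (fun_vs.dim U + fun_vs.dim W) =
      CARD('a) ^ (fun_vs.dim S + fun_vs.dim (U \<inter> W))"
    by (simp add: card_subspace_coord_space[OF U] card_subspace_coord_space[OF W]
        card_subspace_coord_space[OF S] card_subspace_coord_space[OF I] power_add)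
  then have "fun_vs.dim U + fun_vs.dim W = fun_vs.dim S + fun_vs.dim (U \<inter> W)"
    using one_less_CARD_field[where 'a = 'a] by simp
  moreover have "orth n U \<inter> orth n W = orth n S"
  proof
    show "orth n U \<inter> orth n W \<subseteq> orth n S"
      by (auto simp: orth_def S_def distrib_left sum.distrib)
    have "x \<in> S" if "x \<in> U" for x
      unfolding S_def using that fun_vs.subspace_0[OF W(1)] by (intro image_eqI[of _ _ "(x, 0)"]) auto
    moreover have "x \<in> S" if "x \<in> W" for x
      unfolding S_def using that fun_vs.subspace_0[OF U(1)] by (intro image_eqI[of _ _ "(0, x)"]) auto
    ultimately show "orth n S \<subseteq> orth n U \<inter> orth n W" by (auto simp: orth_def)
  qed
  ultimately show ?thesis
    using dim_orth[OF S] dim_le_of_subspace[OF S] by simp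
qed

lemma subspace_dist_orth:
  fixes U W :: "(nat \<Rightarrow> 'a::{field,finite}) set"
  assumes U: "fun_vs.subspace U" "U \<subseteq> coord_space n"
    and W: "fun_vs.subspace W" "W \<subseteq> coord_space n"
  shows "subspace_dist (orth n U) (orth n W) = subspace_dist U W"
  using dim_Int_orth[OF U W] dim_orth[OF U] dim_orth[OF W]
    dim_le_of_subspace[OF U] dim_le_of_subspace[OF W]
  by (simp add: subspace_dist_def)

text \<open>Taking complements is injective on subspaces, being an involution, and preserves
  distances; so it carries an optimal code to a code of the same size in the complementary
  dimension.\<close>

lemma max_code_size_orth_le:
  "max_code_size TYPE('a::{field,finite}) n d k \<le> max_code_size TYPE('a) n d (n - k)"
proof -
  obtain C :: "(nat \<Rightarrow> 'a) set set"
    where C: "cd_code n d k C" "card C = max_code_size TYPE('a) n d k"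
    by (rule max_code_size_attained)
  have sub: "fun_vs.subspace U" "U \<subseteq> coord_space n" "fun_vs.dim U = k" if "U \<in> C" for U
    using C(1) that by (auto simp: cd_code_def grassmannian_def)
  have inj: "inj_on (orth n) C"
    by (rule inj_on_inverseI[of _ "orth n"]) (simp add: orth_orth sub)
  have "cd_code n d (n - k) (orth n ` C)"
    using C(1) sub
    by (auto simp: cd_code_def grassmannian_def subspace_orth dim_orth subspace_dist_orth
        dest: subsetD[OF orth_subset])
  from card_le_max_code_size[OF this] show ?thesis
    using C(2) by (simp add: card_image[OF inj])
qed

theorem max_code_size_dual:
  assumes "k \<le> n"
  shows "max_code_size TYPE('a::{field,finite}) n d k = max_code_size TYPE('a) n d (n - k)"
  using max_code_size_orth_le[where 'a = 'a, of n d k]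
    max_code_size_orth_le[where 'a = 'a, of n d "n - k"] assms by simp

section \<open>Finite extension fields and linearized polynomials\<close>

text \<open>Multiplication by a nonzero \<open>x\<close> permutes the nonzero elements; comparing
  their products gives x^(q-1) = 1.\<close>

lemma power_CARD_eq_self: "(x :: 'a::{field,finite}) ^ CARD('a) = x"
proof (cases "x = 0")
  case True
  then show ?thesis using one_less_CARD_field[where 'a = 'a] by simp
next
  case False
  have "(\<Prod>y\<in>UNIV - {0}. x * y) = \<Prod>(UNIV - {0 :: 'a})"
    by (rule prod.reindex_bij_witness[of _ "\<lambda>y. y / x" "\<lambda>y. x * y"]) (use False in auto)
  then have "x ^ (CARD('a) - 1) = 1"
    by (simp add: prod.distrib card_Diff_singleton)
  moreover have "x ^ CARD('a) = x ^ (CARD('a) - 1) * x"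
    using one_less_CARD_field[where 'a = 'a] by (intro power_minus_mult[symmetric]) linarith
  ultimately show ?thesis by simp
qed

text \<open>This makes q-th powering an iterate of the Frobenius map, hence additive.\<close>

lemma CARD_eq_CHAR_power:
  assumes "primepow CARD('a::{field,finite})"
  obtains m where "Factorial_Ring.prime CHAR('a)" "CARD('a) = CHAR('a) ^ m"
proof -
  have "CHAR('a) > 0" by (rule finite_imp_CHAR_pos) simp
  then have pr: "Factorial_Ring.prime CHAR('a)" by (rule prime_CHAR_semidom)
  obtain p m where pm: "Factorial_Ring.prime p" "CARD('a) = p ^ m"
    using assms by (auto simp: primepow_def)
  have "CHAR('a) dvd p ^ m" using CHAR_dvd_CARD[where 'a = 'a] pm(2) by simp
  then have "CHAR('a) = p" using pr pm(1) by (metis prime_dvd_power primes_dvd_imp_eq)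
  with pr pm(2) that show thesis by blast
qed

lemma power_CARD_power_add:
  fixes x y :: "'a::{field,finite} alg_closure"
  assumes "primepow CARD('a)"
  shows "(x + y) ^ (CARD('a) ^ j) = x ^ (CARD('a) ^ j) + y ^ (CARD('a) ^ j)"
proof -
  obtain m where m: "Factorial_Ring.prime CHAR('a)" "CARD('a) = CHAR('a) ^ m"
    by (rule CARD_eq_CHAR_power[OF assms])
  show ?thesis
    by (rule freshmans_dream'[where n = "m * j"]) (simp_all add: m power_mult)
qed

lemma to_ac_power_CARD: "to_ac (c :: 'a::{field,finite}) ^ (CARD('a) ^ j) = to_ac c"
proof (induction j)
  case (Suc j)
  have "to_ac c ^ CARD('a) = to_ac c"
    by (metis power_CARD_eq_self to_ac_power)
  then show ?case using Suc by (simp add: power_mult)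
qed simp

section \<open>Separable polynomials and the extension field\<close>

lemma order_eq_1_if_pderiv_nz:
  fixes p :: "'a::field poly"
  assumes "poly p x = 0" "poly (pderiv p) x \<noteq> 0"
  shows "order x p = 1"
proof -
  have p: "p \<noteq> 0" using assms(2) by (metis pderiv_0 poly_0)
  have "\<not> 2 \<le> order x p"
  proof
    assume "2 \<le> order x p"
    then have "[:-x, 1:] ^ 2 dvd p" by (simp add: order_divides)
    then obtain r where "p = [:-x, 1:] ^ 2 * r" by (rule dvdE)
    then have "poly (pderiv p) x = 0"
      by (simp only: power2_eq_square mult.assoc pderiv_mult poly_add poly_mult) simp
    with assms(2) show False by simp
  qed
  moreover have "order x p \<noteq> 0" using assms(1) p by (simp add: order_root)
  ultimately show ?thesis by simp
qed

text \<open>Over an algebraically closed field the multiplicities of the roots sum to the degree,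
  and a nonzero derivative at a root makes its multiplicity 1.\<close>

lemma card_roots_separable:
  fixes p :: "'a::alg_closed_field poly"
  assumes p: "p \<noteq> 0" and sep: "\<And>x. poly p x = 0 \<Longrightarrow> poly (pderiv p) x \<noteq> 0"
  shows "card {x. poly p x = 0} = degree p"
proof -
  obtain A where A: "size A = degree p" "p = smult (lead_coeff p) (\<Prod>x\<in>#A. [:-x, 1:])"
    using alg_closed_imp_factorization[OF p] by blast
  have "(\<Prod>x\<in>#B. [:-x, 1:]) \<noteq> 0 \<and> proots (\<Prod>x\<in>#B. [:-x, 1:]) = B" for B :: "'a multiset"
  proof (induction B)
    case (add x B)
    then show ?case
      using proots_mult[of "[:-x, 1:]" "\<Prod>x\<in>#B. [:-x, 1:]"] proots_linear_factor[of "-x"]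
      by (simp del: mult_pCons_left)
  qed simp
  then have "proots p = A"
    using A(2) p by (metis leading_coeff_0_iff proots_smult)
  then have "degree p = size (proots p)" using A(1) by simp
  also have "\<dots> = (\<Sum>x | poly p x = 0. order x p)"
    using p by (simp add: size_multiset_overloaded_eq)
  also have "\<dots> = (\<Sum>x | poly p x = 0. 1)"
    using sep by (intro sum.cong) (auto simp: order_eq_1_if_pderiv_nz)
  finally show ?thesis by simp
qed

text \<open>The extension of degree \<open>n\<close> of \<open>'a\<close>, as the fixed field of the \<open>n\<close>-th power of Frobenius.\<close>
definition fixed_field :: "nat \<Rightarrow> 'a::{field,finite} alg_closure set" where
  "fixed_field n = {x. x ^ (CARD('a) ^ n) = x}"

text \<open>The elements are the roots of X^N - X with N = q^n. The characteristic divides N, so the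
  derivative is -1 and all N roots are simple. Positivity of \<open>n\<close> matters: for n = 0
  every element of the closure is fixed.\<close>

lemma finite_card_fixed_field:
  assumes "n > 0"
  shows "finite (fixed_field n :: 'a::{field,finite} alg_closure set) \<and>
    card (fixed_field n :: 'a alg_closure set) = CARD('a) ^ n"
proof -
  define N where "N = CARD('a) ^ n"
  define p :: "'a alg_closure poly" where "p = monom 1 N - monom 1 1"
  have N: "N > 1"
    unfolding N_def using one_less_CARD_field[where 'a = 'a] assms by (rule one_less_power)
  then have deg: "degree p = N"
    using degree_add_eq_left[of "- monom (1 :: 'a alg_closure) 1" "monom 1 N"]
    by (simp add: p_def degree_monom_eq)
  have "CHAR('a) dvd N"
    unfolding N_def using CHAR_dvd_CARD[where 'a = 'a] dvd_power[of n "CARD('a)"] assms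
    by (meson dvd_trans)
  then have "of_nat N = (0 :: 'a alg_closure)"
    by (subst of_nat_eq_0_iff_char_dvd) simp
  then have "pderiv p = -1"
    by (simp add: p_def pderiv_diff pderiv_monom)
  moreover have p0: "p \<noteq> 0" using deg N by auto
  ultimately have c: "card {x. poly p x = 0} = N"
    using card_roots_separable[of p] deg by simp
  have "{x. poly p x = 0} = fixed_field n"
    by (simp add: p_def fixed_field_def poly_monom flip: N_def)
  with c poly_roots_finite[OF p0] show ?thesis unfolding N_def by simp
qed

definition ac_scale :: "'a::field \<Rightarrow> 'a alg_closure \<Rightarrow> 'a alg_closure" where
  "ac_scale c x = to_ac c * x"

interpretation ac_vs: vector_space ac_scale
  by (rule vector_space.intro) (simp_all add: ac_scale_def distrib_left distrib_right mult.assoc)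

interpretation fun_ac: vector_space_pair fun_scale ac_scale ..

lemma subspace_fixed_field:
  assumes "primepow CARD('a::{field,finite})"
  shows "ac_vs.subspace (fixed_field n :: 'a::{field,finite} alg_closure set)"
  using assms
  by (auto simp: ac_vs.subspace_def fixed_field_def ac_scale_def power_mult_distrib
      power_CARD_power_add to_ac_power_CARD)

text \<open>Both spaces have q^n elements, hence equal dimension. The map allows coordinate vectors
  to serve as arguments and values of polynomials over the extension field.\<close>

lemma coord_space_fixed_field_iso:
  assumes "primepow CARD('a::{field,finite})" "n > 0"
  obtains f :: "(nat \<Rightarrow> 'a::{field,finite}) \<Rightarrow> 'a alg_closure"
  where "Vector_Spaces.linear fun_scale ac_scale f" "f ` coord_space n = fixed_field n" "inj_on f (coord_space n)"
proof -
  let ?V = "coord_space n :: (nat \<Rightarrow> 'a) set" and ?F = "fixed_field n :: 'a alg_closure set"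
  note V = subspace_coord_space finite_coord_space
  note F = subspace_fixed_field[OF assms(1)] finite_card_fixed_field[OF assms(2), THEN conjunct1]
  have "CARD('a) ^ ac_vs.dim ?F = CARD('a) ^ n"
    using ac_vs.card_subspace[OF finite F] finite_card_fixed_field[OF assms(2), where 'a = 'a] by simp
  then have dim: "fun_vs.dim ?V = ac_vs.dim ?F"
    using one_less_CARD_field[where 'a = 'a] by (simp add: dim_coord_space)
  obtain B where B: "B \<subseteq> ?V" "fun_vs.independent B" "?V \<subseteq> fun_vs.span B" "card B = fun_vs.dim ?V"
    by (rule fun_vs.basis_exists)
  obtain C where C: "C \<subseteq> ?F" "ac_vs.independent C" "?F \<subseteq> ac_vs.span C" "card C = ac_vs.dim ?F"
    by (rule ac_vs.basis_exists)
  show thesis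
    using fun_ac.finite_basis_to_basis_subspace_isomorphism[OF V(1) F(1) dim
        finite_subset[OF B(1) V(2)] B finite_subset[OF C(1) F(2)] C] that by blast
qed

section \<open>Linearized polynomials\<close>

text \<open>A linearized polynomial of q-degree at most \<open>t\<close>: since only exponents q^j
  occur, it acts linearly over the base field. These maps form the Gabidulin code.\<close>

definition lin_poly :: "nat \<Rightarrow> (nat \<Rightarrow> 'a::{field,finite} alg_closure) \<Rightarrow> 'a alg_closure \<Rightarrow> 'a alg_closure" where
  "lin_poly t a x = (\<Sum>j\<le>t. a j * x ^ (CARD('a) ^ j))"

lemma lin_poly_add:
  "primepow CARD('a::{field,finite}) \<Longrightarrow>
    lin_poly t (a :: nat \<Rightarrow> 'a alg_closure) (x + y) = lin_poly t a x + lin_poly t a y"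
  by (simp add: lin_poly_def power_CARD_power_add distrib_left sum.distrib)

lemma lin_poly_scale: "lin_poly t a (ac_scale c x) = ac_scale c (lin_poly t a x)"
  by (simp add: lin_poly_def ac_scale_def power_mult_distrib to_ac_power_CARD sum_distrib_left mult_ac)

lemma lin_poly_diff: "lin_poly t (\<lambda>j. a j - b j) x = lin_poly t a x - lin_poly t b x"
  by (simp add: lin_poly_def left_diff_distrib sum_subtractf)

lemma lin_poly_closed:
  assumes "primepow CARD('a::{field,finite})"
    and "\<And>j. j \<le> t \<Longrightarrow> a j \<in> fixed_field n" "x \<in> fixed_field n"
  shows "lin_poly t a x \<in> (fixed_field n :: 'a::{field,finite} alg_closure set)"
proof -
  have "a j * x ^ (CARD('a) ^ j) \<in> fixed_field n" if "j \<le> t" for j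
    using assms(2)[OF that] assms(3)
    by (simp add: fixed_field_def power_mult_distrib) (metis mult.commute power_mult)
  then show ?thesis
    unfolding lin_poly_def by (intro ac_vs.subspace_sum[OF subspace_fixed_field[OF assms(1)]]) auto
qed

text \<open>The ordinary degree is at most q^t. For the code this means that two distinct
  polynomials agree on at most q^t points.\<close>

lemma card_lin_poly_roots:
  fixes a :: "nat \<Rightarrow> 'a::{field,finite} alg_closure"
  assumes "j \<le> t" "a j \<noteq> 0"
  shows "finite {x. lin_poly t a x = 0} \<and> card {x. lin_poly t a x = 0} \<le> CARD('a) ^ t"
proof -
  let ?q = "CARD('a)"
  define p where "p = (\<Sum>i\<le>t. monom (a i) (?q ^ i))"
  have q: "1 < ?q" by (rule one_less_CARD_field)
  \<comment> \<open>The exponents q^i are pairwise distinct because q > 1, so no cancellation can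
    occur at q^j.\<close>
  have "coeff p (?q ^ j) = (\<Sum>i\<le>t. if i = j then a i else 0)"
    unfolding p_def coeff_sum using q by (intro sum.cong) auto
  then have "p \<noteq> 0" using assms by auto
  moreover have "degree p \<le> ?q ^ t"
    unfolding p_def
    by (intro degree_sum_le) (use q in \<open>auto intro!: order_trans[OF degree_monom_le] power_increasing\<close>)
  moreover have "{x. poly p x = 0} = {x. lin_poly t a x = 0}"
    by (simp add: p_def lin_poly_def poly_sum poly_monom)
  ultimately show ?thesis
    using card_poly_roots_bound[of p] poly_roots_finite[of p] by simp
qed

section \<open>Lifted Gabidulin codes\<close>

text \<open>Together with \<open>high_part\<close> this separates argument and value coordinates, so
  that codewords can be graphs.\<close>

definition low_part :: "nat \<Rightarrow> (nat \<Rightarrow> 'a::zero) \<Rightarrow> nat \<Rightarrow> 'a" where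
  "low_part k z = (\<lambda>i. if i < k then z i else 0)"

definition high_part :: "nat \<Rightarrow> (nat \<Rightarrow> 'a) \<Rightarrow> nat \<Rightarrow> 'a" where
  "high_part k z = (\<lambda>i. z (i + k))"

lemma low_part_in: "low_part k z \<in> coord_space k"
  by (simp add: low_part_def coord_space_def)

lemma high_part_in: "z \<in> coord_space (k + n) \<Longrightarrow> high_part k z \<in> coord_space n"
  by (simp add: high_part_def coord_space_def)

lemma low_high_part_eqI:
  assumes "low_part k z = low_part k z'" "high_part k z = high_part k z'"
  shows "z = z'"
proof
  fix i
  show "z i = z' i"
    using fun_cong[OF assms(1), of i] fun_cong[OF assms(2), of "i - k"]
    by (cases "i < k") (simp_all add: low_part_def high_part_def)
qed

text \<open>There are q^(n (t+1)) choices of \<open>t + 1\<close> coefficients in the extension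
  field. Two graphs meet only above roots of the difference polynomial, hence in dimension at most
  \<open>t\<close>. The condition k \<le> n makes room for the \<open>k\<close> argument coordinates
  inside the extension field.\<close>

lemma lifted_code_exists:
  assumes pp: "primepow CARD('a::{field,finite})" and kn: "k \<le> n" "0 < n" and tk: "t < k"
  shows "\<exists>C :: (nat \<Rightarrow> 'a::{field,finite}) set set.
    cd_code (k + n) (2 * (k - t)) k C \<and> card C = CARD('a) ^ (n * (t + 1))"
proof -
  let ?q = "CARD('a)"
  obtain f :: "(nat \<Rightarrow> 'a) \<Rightarrow> 'a alg_closure" where
    f: "Vector_Spaces.linear fun_scale ac_scale f" "f ` coord_space n = fixed_field n"
      "inj_on f (coord_space n)"
    using coord_space_fixed_field_iso[OF pp kn(2)] by blast
  have f_add: "f (x + y) = f x + f y" and f_scale: "f (fun_scale c x) = ac_scale c (f x)" for x y c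
    using f(1) by (simp_all add: Vector_Spaces.linear_iff)
  have q: "1 < ?q" by (rule one_less_CARD_field)
  have low_n: "low_part k z \<in> coord_space n" for z :: "nat \<Rightarrow> 'a"
    using low_part_in coord_space_mono[OF kn(1)] by blast
  have f_in: "f x \<in> fixed_field n" if "x \<in> coord_space n" for x
    using f(2) that by blast
  txt \<open>The lifted Gabidulin code: \<open>U a\<close> is the graph of the restriction of \<open>lin_poly t a\<close> to
    a \<open>k\<close>-dimensional subspace of \<open>fixed_field n\<close>, read in the coordinates given by \<open>f\<close>.\<close>
  define U where "U a = {z \<in> coord_space (k + n). f (high_part k z) = lin_poly t a (f (low_part k z))}"
    for a
  define A where "A = PiE {..t} (\<lambda>_. fixed_field n :: 'a alg_closure set)"
  have U_eqI: "z = z'"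
    if "z \<in> U a" "z' \<in> U a" "low_part k z = low_part k z'" for a z z'
  proof -
    have "f (high_part k z) = f (high_part k z')" using that by (simp add: U_def)
    then have "high_part k z = high_part k z'"
      by (rule inj_onD[OF f(3)]) (use that in \<open>auto simp: U_def intro: high_part_in\<close>)
    with that(3) show ?thesis by (rule low_high_part_eqI)
  qed
  have sub: "fun_vs.subspace (U a)" for a
  proof -
    have low: "low_part k (x + y) = low_part k x + low_part k y"
      "low_part k (fun_scale c x) = fun_scale c (low_part k x)" for x y :: "nat \<Rightarrow> 'a" and c
      by (auto simp: low_part_def fun_scale_def)
    have high: "high_part k (x + y) = high_part k x + high_part k y"
      "high_part k (fun_scale c x) = fun_scale c (high_part k x)" for x y :: "nat \<Rightarrow> 'a" and c
      by (auto simp: high_part_def fun_scale_def)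
    have "fun_scale 0 0 = (0 :: nat \<Rightarrow> 'a)" by simp
    then have "0 \<in> U a"
      using low(2)[of 0 0] high(2)[of 0 0] f_scale[of 0] lin_poly_scale[of t a 0]
        fun_vs.subspace_0[OF subspace_coord_space]
      unfolding U_def by simp
    then show ?thesis
      using subspace_coord_space[of "k + n"]
      by (auto simp: fun_vs.subspace_def U_def low high f_add f_scale lin_poly_add[OF pp] lin_poly_scale)
  qed
  have U_coord: "U a \<subseteq> coord_space (k + n)" for a by (auto simp: U_def)
  have dim: "fun_vs.dim (U a) = k" if a: "a \<in> A" for a
  proof (rule dim_eq_of_card[OF sub U_coord])
    \<comment> \<open>A graph projects bijectively onto its domain; surjectivity uses that the
      polynomial maps the extension field to itself, so its value can be pulled back through
      \<open>f\<close>.\<close>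
    have "bij_betw (low_part k) (U a) (coord_space k)"
    proof (rule bij_betw_imageI)
      show "inj_on (low_part k) (U a)" by (auto intro: inj_onI U_eqI)
      show "low_part k ` U a = coord_space k"
      proof (intro subset_antisym subsetI)
        fix x :: "nat \<Rightarrow> 'a" assume x: "x \<in> coord_space k"
        then have "x \<in> coord_space n" using coord_space_mono[OF kn(1)] by blast
        then have "lin_poly t a (f x) \<in> fixed_field n"
          using a f_in by (intro lin_poly_closed[OF pp]) (auto simp: A_def PiE_iff)
        then obtain y where y: "y \<in> coord_space n" "f y = lin_poly t a (f x)"
          unfolding f(2)[symmetric] by force
        define z where "z = (\<lambda>i. if i < k then x i else y (i - k))"
        have "low_part k z = x" "high_part k z = y"
          using x by (auto simp: z_def low_part_def high_part_def coord_space_def fun_eq_iff)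
        moreover have "z \<in> coord_space (k + n)"
          using y(1) by (auto simp: z_def coord_space_def)
        ultimately show "x \<in> low_part k ` U a" using y(2) by (force simp: U_def)
      qed (use low_part_in in auto)
    qed
    then show "card (U a) = ?q ^ k"
      by (simp add: bij_betw_same_card card_coord_space)
  qed
  have dim_Int: "fun_vs.dim (U a \<inter> U b) \<le> t" if ab: "a \<in> A" "b \<in> A" "a \<noteq> b" for a b
  proof -
    \<comment> \<open>Members of \<open>A\<close> are extensional, so distinct ones differ at an
      index at most \<open>t\<close>.\<close>
    obtain j where j: "j \<le> t" "a j - b j \<noteq> 0"
      using ab PiE_ext[of a "{..t}" _ b] by (force simp: A_def)
    let ?R = "{x. lin_poly t (\<lambda>j. a j - b j) x = 0}"
    note R = card_lin_poly_roots[of j t "\<lambda>j. a j - b j", OF j]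
    have inj: "inj_on (\<lambda>z. f (low_part k z)) (U a \<inter> U b)"
    proof (rule inj_onI)
      fix z z' assume z: "z \<in> U a \<inter> U b" "z' \<in> U a \<inter> U b" "f (low_part k z) = f (low_part k z')"
      then have "low_part k z = low_part k z'"
        by (intro inj_onD[OF f(3)] low_n)
      then show "z = z'" using z U_eqI[of z a z'] by simp
    qed
    have im: "(\<lambda>z. f (low_part k z)) ` (U a \<inter> U b) \<subseteq> ?R"
      by (auto simp: lin_poly_diff U_def)
    have "card (U a \<inter> U b) \<le> ?q ^ t"
      using card_inj_on_le[OF inj im] R by simp
    then have "?q ^ fun_vs.dim (U a \<inter> U b) \<le> ?q ^ t"
      by (simp add: card_subspace_coord_space[OF fun_vs.subspace_inter[OF sub sub] le_infI1[OF U_coord]])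
    then show ?thesis using q by simp
  qed
  have inj: "inj_on U A"
  proof (rule inj_onI, rule ccontr)
    \<comment> \<open>Equal graphs would intersect in dimension \<open>k\<close>, which exceeds
      \<open>t\<close>.\<close>
    fix a b assume "a \<in> A" "b \<in> A" "U a = U b" "a \<noteq> b"
    then show False using dim_Int[of a b] dim[of b] tk by simp
  qed
  have "cd_code (k + n) (2 * (k - t)) k (U ` A)"
    unfolding cd_code_def
  proof (intro conjI ballI impI)
    show "U ` A \<subseteq> grassmannian (k + n) k"
      using sub U_coord dim by (auto simp: grassmannian_def)
    fix S T assume "S \<in> U ` A" "T \<in> U ` A" "S \<noteq> T"
    then obtain a b where ab: "a \<in> A" "b \<in> A" "a \<noteq> b" "S = U a" "T = U b" by auto
    then show "int (2 * (k - t)) \<le> subspace_dist S T"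
      using dim_Int[OF ab(1-3)] dim[OF ab(1)] dim[OF ab(2)] tk by (simp add: subspace_dist_def)
  qed
  moreover have "card (U ` A) = ?q ^ (n * (t + 1))"
    unfolding card_image[OF inj] unfolding A_def
    using finite_card_fixed_field[OF kn(2), where 'a = 'a]
    by (simp add: card_PiE power_add power_mult)
  ultimately show ?thesis by blast
qed

section \<open>Comparison of the two bounds\<close>

text \<open>A product of numbers 1 - x_i with x_i in [0,1] is at least 1 minus the sum of the x_i.
  Here x_i \<le> 2^i / 2^k, and these bounds sum to (2^s - 1) / 2^k, which is below 1/2 because s
  \<le> k - 1.\<close>

lemma prod_one_minus_power_gt_half:
  fixes Q :: real
  assumes Q: "2 \<le> Q" and s: "s + 1 \<le> k"
  shows "(\<Prod>i<s. 1 - 1 / Q ^ (k - i)) > 1 / 2"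
proof -
  have "(\<Prod>i<s. 1 - 1 / Q ^ (k - i)) \<ge> 1 - (2 ^ s - 1) / 2 ^ k" if "s \<le> k" for s
    using that
  proof (induction s)
    case (Suc s)
    let ?P = "\<Prod>i<s. 1 - 1 / Q ^ (k - i)"
    have "0 \<le> 1 - 1 / Q ^ (k - i)" for i using Q by (simp add: field_simps one_le_power)
    moreover have "1 - 1 / Q ^ (k - i) \<le> 1" for i using Q by simp
    ultimately have P: "0 \<le> ?P" "?P \<le> 1" by (auto intro!: prod_nonneg prod_le_1)
    have "2 ^ (k - s) \<le> Q ^ (k - s)" using Q by (intro power_mono) auto
    then have "1 / Q ^ (k - s) \<le> 1 / 2 ^ (k - s)"
      using Q by (intro divide_left_mono) auto
    also have "\<dots> = 2 ^ s / 2 ^ k"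
      using Suc.prems by (simp add: power_diff)
    finally have "?P * (1 / Q ^ (k - s)) \<le> 1 * (2 ^ s / 2 ^ k)"
      using P Q by (intro mult_mono) auto
    moreover have "1 - (2 ^ s - 1) / 2 ^ k \<le> ?P" using Suc by simp
    moreover have "(\<Prod>i<Suc s. 1 - 1 / Q ^ (k - i)) = ?P - ?P * (1 / Q ^ (k - s))"
      by (simp add: algebra_simps)
    moreover have "(2 ^ Suc s - 1 :: real) / 2 ^ k = (2 ^ s - 1) / 2 ^ k + 2 ^ s / 2 ^ k"
      by (simp add: field_simps)
    ultimately show ?case by linarith
  qed simp
  moreover have "(2 :: real) ^ s - 1 < 2 ^ k / 2"
  proof -
    have "(2 :: real) ^ s \<le> 2 ^ (k - 1)" using s by (intro power_increasing) auto
    also have "\<dots> = 2 ^ k / 2" using s by (simp add: power_diff)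
    finally show ?thesis by simp
  qed
  then have "1 - (2 ^ s - 1) / 2 ^ k > (1 / 2 :: real)" by (simp add: field_simps)
  ultimately show ?thesis using s by (meson less_le_trans le_add1 order_trans)
qed

text \<open>Up to the factor P, the left side is at most Q^((n+1)(t+1)). The slack t + 2 \<le> k
  puts this a factor Q \<ge> 2 below Q^(n(t+1)+k), whereas the right side loses only P (1 - 1/Q^k) >
  1/2.\<close>

lemma code_size_comparison:
  fixes Q a b :: real
  assumes Q: "2 \<le> Q" and t: "t + 2 \<le> k" and a: "0 \<le> a"
    and a_le: "a * (\<Prod>i<t. Q ^ (k - 1) - Q ^ i) \<le> (\<Prod>i<t. Q ^ (n + k) - Q ^ i)"
    and b_ge: "Q ^ (n * (t + 1)) \<le> b"
  shows "a * (Q ^ (n + 1) - 1) < b * (Q ^ k - 1)"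
proof -
  define P where "P = (\<Prod>i<t. 1 - 1 / Q ^ (k - 1 - i))"
  have half: "P * (1 - 1 / Q ^ k) > 1 / 2"
  proof -
    \<comment> \<open>The factor at i = 0 is split off and the index shifted, so the
      \<open>t\<close> factors with base exponent \<open>k - 1\<close> become part of a product of
      \<open>t + 1\<close> factors with base exponent \<open>k\<close>.\<close>
    have "(\<Prod>i<Suc t. 1 - 1 / Q ^ (k - i)) = (1 - 1 / Q ^ k) * P"
      unfolding P_def by (subst prod.lessThan_Suc_shift) simp
    then show ?thesis
      using prod_one_minus_power_gt_half[OF Q, of "Suc t" k] t by (simp add: mult.commute)
  qed
  have P: "0 < P"
    unfolding P_def using Q t by (intro prod_pos) (auto simp: one_less_power)
  have "Q ^ (k - 1) - Q ^ i = Q ^ (k - 1) * (1 - 1 / Q ^ (k - 1 - i))" if "i < t" for i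
  proof -
    have "Q ^ (k - 1) = Q ^ i * Q ^ (k - 1 - i)"
      using that t by (subst power_add[symmetric]) simp
    moreover have "Q ^ (k - 1 - i) \<noteq> 0" using Q by simp
    ultimately show ?thesis by (simp add: right_diff_distrib)
  qed
  then have eq: "(\<Prod>i<t. Q ^ (k - 1) - Q ^ i) = Q ^ ((k - 1) * t) * P"
    by (simp add: P_def prod.distrib power_mult)
  \<comment> \<open>Dropping each Q^i leaves Q^((n+k)t); writing n + k = (k-1) + (n+1) isolates the
    power that cancels against the other side.\<close>
  have "(\<Prod>i<t. Q ^ (n + k) - Q ^ i) \<le> (\<Prod>i<t. Q ^ (n + k))"
    using Q t by (intro prod_mono) (auto intro!: power_increasing)
  also have "\<dots> = Q ^ ((k - 1) * t) * Q ^ ((n + 1) * t)"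
  proof -
    have "n + k = (k - 1) + (n + 1)" using t by simp
    then have "(k - 1) * t + (n + 1) * t = (n + k) * t" by (simp only: add_mult_distrib)
    then show ?thesis by (simp only: prod_constant card_lessThan flip: power_add power_mult)
  qed
  finally have "a * (Q ^ ((k - 1) * t) * P) \<le> Q ^ ((k - 1) * t) * Q ^ ((n + 1) * t)"
    using a_le unfolding eq by (rule order_trans[rotated])
  then have "Q ^ ((k - 1) * t) * (a * P) \<le> Q ^ ((k - 1) * t) * Q ^ ((n + 1) * t)"
    by (simp only: mult.left_commute mult.commute)
  then have aP: "a * P \<le> Q ^ ((n + 1) * t)"
    using Q by simp
  have "a * (Q ^ (n + 1) - 1) * P \<le> Q ^ (n + 1) * (a * P)"
    using a P by (simp only: left_diff_distrib right_diff_distrib mult_ac) simp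
  also have "\<dots> \<le> Q ^ (n + 1) * Q ^ ((n + 1) * t)"
    using Q aP by (intro mult_left_mono) auto
  also have "\<dots> = Q ^ (n * (t + 1) + t + 1)"
    by (subst power_add[symmetric]) (simp add: algebra_simps)
  also have "\<dots> \<le> Q ^ (n * (t + 1) + k - 1)"
    using Q t by (intro power_increasing) auto
  also have "\<dots> = Q ^ (n * (t + 1)) * Q ^ k / Q"
    using Q t by (simp add: power_add power_diff)
  also have "\<dots> \<le> Q ^ (n * (t + 1)) * Q ^ k * (1 / 2)"
    using Q by (simp add: field_simps)
  also have "\<dots> < Q ^ (n * (t + 1)) * Q ^ k * (P * (1 - 1 / Q ^ k))"
    using Q half by (intro mult_strict_left_mono) auto
  also have "\<dots> = Q ^ (n * (t + 1)) * ((Q ^ k - 1) * P)"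
    using Q by (simp add: field_simps)
  also have "\<dots> \<le> b * ((Q ^ k - 1) * P)"
    using b_ge Q P by (intro mult_right_mono) (auto simp: one_le_power)
  finally have "a * (Q ^ (n + 1) - 1) * P < b * (Q ^ k - 1) * P" by (simp add: mult_ac)
  then show ?thesis using P by simp
qed

text \<open>The integer gap of at least 1 is multiplied by (xy - 1) / ((x-1)(y-1)) \<ge> 1, so the
  real numbers still differ by at least 1 and their floors are distinct.\<close>

lemma floor_less_floor_scaled:
  fixes a b x y :: nat
  assumes xy: "1 < x" "1 < y" and lt: "a * (y - 1) < b * (x - 1)"
  shows "\<lfloor>(real x * real y - 1) / (real x - 1) * real a\<rfloor>
    < \<lfloor>(real x * real y - 1) / (real y - 1) * real b\<rfloor>"
proof -
  define u w m where "u = real x - 1" and "w = real y - 1" and "m = real x * real y - 1"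
  have pos: "0 < u" "0 < w" using xy by (auto simp: u_def w_def)
  have "real (a * (y - 1) + 1) \<le> real (b * (x - 1))" using lt by linarith
  then have diff: "real a * w + 1 \<le> real b * u" using xy by (simp add: u_def w_def of_nat_diff)
  have "u * w \<le> m" using xy by (simp add: u_def w_def m_def algebra_simps)
  then have m_ge: "1 \<le> m / (u * w)" using pos by simp
  have "m / u * real a + 1 \<le> m / u * real a + m / (u * w)" using m_ge by simp
  also have "\<dots> = m / (u * w) * (real a * w + 1)"
    using pos by (simp add: field_simps)
  also have "\<dots> \<le> m / (u * w) * (real b * u)"
    using diff m_ge by (intro mult_left_mono) auto
  also have "\<dots> = m / w * real b"
    using pos by (simp add: field_simps)
  finally have "m / u * real a + 1 \<le> m / w * real b" .
  then have "\<lfloor>m / u * real a\<rfloor> < \<lfloor>m / w * real b\<rfloor>" by linarith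
  then show ?thesis by (simp add: u_def w_def m_def)
qed

theorem proposition3:
  fixes q v d k :: nat
  assumes "primepow q"
    and "CARD('a::{field,finite}) = q"
    and "2 \<le> k" and "k + 2 \<le> v"
    and "even d" and "4 \<le> d" and "d \<le> 2 * min k (v - k)"
    and "real k \<le> real v / 2"
  shows "\<lfloor>(real q ^ v - 1) / (real q ^ k - 1) * real (max_code_size TYPE('a) (v - 1) d (k - 1))\<rfloor>
       \<le> \<lfloor>(real q ^ v - 1) / (real q ^ (v - k) - 1) * real (max_code_size TYPE('a) (v - 1) d k)\<rfloor>
    \<and> (\<lfloor>(real q ^ v - 1) / (real q ^ k - 1) * real (max_code_size TYPE('a) (v - 1) d (k - 1))\<rfloor>
       = \<lfloor>(real q ^ v - 1) / (real q ^ (v - k) - 1) * real (max_code_size TYPE('a) (v - 1) d k)\<rfloor>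
       \<longleftrightarrow> v = 2 * k)"
proof (cases "v = 2 * k")
  case True
  \<comment> \<open>In dimension 2k - 1 the complements of (k-1)-spaces are k-spaces.\<close>
  then have "max_code_size TYPE('a) (v - 1) d (k - 1) = max_code_size TYPE('a) (v - 1) d k"
    using max_code_size_dual[where 'a = 'a, of "k - 1" "v - 1" d] assms(3) by simp
  moreover have "v - k = k" using True by simp
  ultimately show ?thesis using True by simp
next
  case False
  define n where "n = v - 1 - k"
  \<comment> \<open>Subtraction is exact because d/2 \<le> k, and d \<ge> 4 gives t \<le> k - 2. The
    value t = 0 occurs for d = 2k, where the packing bound reads a \<le> 1.\<close>
  define t where "t = k - d div 2"
  define a where "a = max_code_size TYPE('a) (v - 1) d (k - 1)"
  define b where "b = max_code_size TYPE('a) (v - 1) d k"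
  \<comment> \<open>Excluding v = 2k leaves v \<ge> 2k + 1, which is exactly k \<le> n as the lifted
    code requires.\<close>
  have v: "v - 1 = k + n" "v - k = n + 1" "k \<le> n" "0 < n" "v = k + (n + 1)"
    using False assms(3,4,8) by (auto simp: n_def)
  have d: "2 * (k - t) = d" "t < k" "t + 2 \<le> k"
    using assms(5-7) by (auto simp: t_def elim!: evenE)
  have pp: "primepow CARD('a)" using assms(1,2) by simp
  have q: "1 < q" using one_less_CARD_field[where 'a = 'a] assms(2) by simp
  obtain C :: "(nat \<Rightarrow> 'a) set set" where C: "cd_code (v - 1) d (k - 1) C" "card C = a"
    unfolding a_def by (rule max_code_size_attained)
  \<comment> \<open>The distance condition reads 2(k-1) - 2 dim \<ge> 2(k-t); codeword dimension
    \<open>k - 1\<close> instead of \<open>k\<close> makes the bound strict.\<close>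
  have "fun_vs.dim (U \<inter> W) < t" if UW: "U \<in> C" "W \<in> C" "U \<noteq> W" for U W
  proof -
    have "fun_vs.dim U = k - 1" "fun_vs.dim W = k - 1" "int d \<le> subspace_dist U W"
      using C(1) UW by (auto simp: cd_code_def grassmannian_def)
    then show ?thesis using d assms(3) by (simp add: subspace_dist_def)
  qed
  then have "card C * (\<Prod>i<t. CARD('a) ^ (k - 1) - CARD('a) ^ i)
      \<le> (\<Prod>i<t. CARD('a) ^ (v - 1) - CARD('a) ^ i)"
    using C(1) by (intro card_code_le) (auto simp: cd_code_def)
  then have "a * (\<Prod>i<t. q ^ (k - 1) - q ^ i) \<le> (\<Prod>i<t. q ^ (n + k) - q ^ i)"
    using assms(2) C(2) v(1) by (simp add: add.commute)
  then have "real (a * (\<Prod>i<t. q ^ (k - 1) - q ^ i)) \<le> real (\<Prod>i<t. q ^ (n + k) - q ^ i)"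
    by (simp only: of_nat_le_iff)
  \<comment> \<open>With t \<le> m no difference is truncated, so the packing bound passes to the
    reals factor by factor.\<close>
  moreover have "real (\<Prod>i<t. q ^ m - q ^ i) = (\<Prod>i<t. real q ^ m - real q ^ i)" if "t \<le> m" for m
    unfolding of_nat_prod using that q by (intro prod.cong) (auto simp: of_nat_diff power_increasing)
  ultimately have a_le: "real a * (\<Prod>i<t. real q ^ (k - 1) - real q ^ i)
      \<le> (\<Prod>i<t. real q ^ (n + k) - real q ^ i)"
    using d(3) by simp
  obtain C' :: "(nat \<Rightarrow> 'a) set set"
    where C': "cd_code (k + n) (2 * (k - t)) k C'" "card C' = CARD('a) ^ (n * (t + 1))"
    using lifted_code_exists[OF pp v(3,4) d(2)] by blast
  have "q ^ (n * (t + 1)) \<le> b"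
    using card_le_max_code_size[OF C'(1)] C'(2) assms(2) d(1) v(1) by (simp add: b_def)
  then have "real q ^ (n * (t + 1)) \<le> real b" by (metis of_nat_le_iff of_nat_power)
  then have "real a * (real q ^ (n + 1) - 1) < real b * (real q ^ k - 1)"
    using q d(3) a_le by (intro code_size_comparison) auto
  then have "real (a * (q ^ (n + 1) - 1)) < real (b * (q ^ k - 1))"
    using q by (simp add: of_nat_diff)
  then have "a * (q ^ (n + 1) - 1) < b * (q ^ k - 1)" by (simp only: of_nat_less_iff)
  moreover have "1 < q ^ k" "1 < q ^ (n + 1)" 
    using one_less_power[OF q, of k] one_less_power[OF q, of "n + 1"] assms(3) by simp_all
  moreover have "real q ^ v = real (q ^ k) * real (q ^ (n + 1))" by (simp add: v(5) power_add)
  ultimately have "\<lfloor>(real q ^ v - 1) / (real q ^ k - 1) * real a\<rfloor>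
      < \<lfloor>(real q ^ v - 1) / (real q ^ (v - k) - 1) * real b\<rfloor>"
    using floor_less_floor_scaled[of "q ^ k" "q ^ (n + 1)" a b] v(2) by simp
  then show ?thesis using False by (simp add: a_def b_def)
qed

end
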